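(* Let $n\ge 3$ and let $S\in\mathcal{S}_{1,2,\overline{4},7}\cup\mathcal{S}_{1,3,\overline{4},7}\cup\mathcal{S}_{1,3,\overline{5},6}$. Then the cycle $C_n$ is $\chi_S$-critical if and only if $n\not\equiv 0\pmod 8$ and $n\ne 4$.
   Context: A packing sequence is a non-decreasing infinite sequence $S=(s_1,s_2,\ldots)$ of positive integers. For a graph $G$, a map $\phi\colon V(G)\to\{1,\ldots,k\}$ is an $S$-packing $k$-coloring if any two distinct vertices $u,v$ with $\phi(u)=\phi(v)=i$ satisfy $d_G(u,v) > s_i$; $\chi_S(G)$ is the least such $k$. A graph $G$ is $\chi_S$-critical if $\chi_S(H)<\chi_S(G)$ for every proper subgraph $H$ of $G$. Notation: $\mathcal{S}_{a_1,a_2,\overline{a_3},a_4}$ is the set of packing sequences with $s_1=a_1$, $s_2=a_2$, $a_3\le s_3\le a_4$, $s_4=a_4$ (later entries arbitrary subject to being a packing sequence). So $\mathcal{S}_{1,2,\overline{4},7}$: $s_1=1,s_2=2,4\le s_3\le 7,s_4=7$; $\mathcal{S}_{1,3,\overline{4},7}$: $s_1=1,s_2=3,4\le s_3\le7,s_4=7$; $\mathcal{S}_{1,3,\overline{5},6}$: $s_1=1,s_2=3,5\le s_3\le 6,s_4=6$. *)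

theory Defs
  imports "Graph_Theory.Graph_Theory"
begin

text \<open>
  A finite simple graph is a \<open>pair_graph\<close>: a finite, loop-free, symmetric set of vertex pairs, an
  edge \<open>uv\<close> being the two arcs \<open>(u, v)\<close> and \<open>(v, u)\<close>. The definitions below are meant for such
  graphs.
\<close>

text \<open>Graph distance: the least length of a walk, and \<open>\<infinity>\<close> between different components.\<close>

definition gdist :: "'a pair_pre_digraph \<Rightarrow> 'a \<Rightarrow> 'a \<Rightarrow> ereal" where
  "gdist G u v = wf_digraph.\<mu> (with_proj G) (\<lambda>_. 1) u v"

text \<open>Sequences are indexed from 1, as are the colours; the value \<open>s 0\<close> is never used.\<close>

definition packing_seq :: "(nat \<Rightarrow> nat) \<Rightarrow> bool" where
  "packing_seq s \<longleftrightarrow> (\<forall>i\<ge>1. 0 < s i) \<and> mono_on {1..} s"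

definition packing_seqs :: "nat \<Rightarrow> nat \<Rightarrow> nat \<Rightarrow> nat \<Rightarrow> (nat \<Rightarrow> nat) set" where
  "packing_seqs a1 a2 a3 a4 =
     {s. packing_seq s \<and> s 1 = a1 \<and> s 2 = a2 \<and> a3 \<le> s 3 \<and> s 3 \<le> a4 \<and> s 4 = a4}"

definition packing_coloring ::
  "(nat \<Rightarrow> nat) \<Rightarrow> 'a pair_pre_digraph \<Rightarrow> nat \<Rightarrow> ('a \<Rightarrow> nat) \<Rightarrow> bool" where
  "packing_coloring s G k \<phi> \<longleftrightarrow>
     \<phi> ` pverts G \<subseteq> {1..k} \<and>
     (\<forall>u\<in>pverts G. \<forall>v\<in>pverts G. u \<noteq> v \<longrightarrow> \<phi> u = \<phi> v \<longrightarrow> gdist G u v > ereal (real (s (\<phi> u))))"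

text \<open>On a finite vertex set an injective colouring is always admissible, so the minimum exists.\<close>

definition packing_chromatic_number :: "(nat \<Rightarrow> nat) \<Rightarrow> 'a pair_pre_digraph \<Rightarrow> nat" where
  "packing_chromatic_number s G = (LEAST k. \<exists>\<phi>. packing_coloring s G k \<phi>)"

lemma packing_coloring_exists:
  assumes "finite (pverts G)"
  shows "\<exists>k \<phi>. packing_coloring s G k \<phi>"
proof -
  obtain f where f: "bij_betw f (pverts G) {1..card (pverts G)}"
    using finite_same_card_bij[OF assms, of "{1..card (pverts G)}"] by auto
  then have "packing_coloring s G (card (pverts G)) f"
    by (auto simp: packing_coloring_def bij_betw_def inj_on_def)
  then show ?thesis by blast
qed

text \<open>
  The library relation \<open>subgraph\<close> is the one of digraphs; requiring \<open>pair_graph H\<close> makes \<open>H\<close> an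
  undirected subgraph, with an arbitrary (not necessarily nonempty) set of vertices.
\<close>

definition chi_critical :: "(nat \<Rightarrow> nat) \<Rightarrow> 'a pair_pre_digraph \<Rightarrow> bool" where
  "chi_critical s G \<longleftrightarrow>
     (\<forall>H. pair_graph H \<and> subgraph (with_proj H) (with_proj G) \<and> H \<noteq> G \<longrightarrow>
        packing_chromatic_number s H < packing_chromatic_number s G)"

definition cycle_graph :: "nat \<Rightarrow> nat pair_pre_digraph" where
  "cycle_graph n = \<lparr> pverts = {..<n},
     parcs = {(u, v). u < n \<and> v < n \<and> (v = Suc u mod n \<or> u = Suc v mod n)} \<rparr>"

lemma pair_graph_cycle_graph:
  assumes "n \<ge> 3"
  shows "pair_graph (cycle_graph n)"
proof -
  have "finite (parcs (cycle_graph n))"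
    by (rule finite_subset[of _ "{..<n} \<times> {..<n}"]) (auto simp: cycle_graph_def)
  then show ?thesis
    using assms
    by unfold_locales
      (auto simp: cycle_graph_def symmetric_def sym_def mod_Suc arcs_ends_def arc_to_ends_def
        split: if_splits)
qed

end

theory Submission
  imports Defs
begin

text \<open>
  Repeating 1, 2, 1, 3, 1, 2, 1, 4 colours every path, and every cycle whose length is divisible by 8,
  with four colours; three of them suffice on paths with at most 7 vertices, two on paths with at most 3.
  Conversely, any 4 consecutive vertices need a colour above 2 and any 8 consecutive vertices a colour
  above 3. In a 4-coloured cycle of length at least 9 two vertices of colour 4 cannot be closer than 8,
  so colour 4 recurs exactly every 8 steps, and 8 divides the length. A proper subgraph of the cycle
  embeds in a path, whereas for \<open>n = 4\<close> and \<open>8 dvd n\<close> the spanning path already needs as many colours as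
  the cycle.
\<close>

section \<open>Distance bounds from walks\<close>

text \<open>Each arc moves the potential by 1 or -1 modulo \<open>m\<close>; \<open>w\<close> is the
  sum of these signs along the walk.\<close>

lemma awalk_winding:
  fixes p :: "'a \<Rightarrow> int"
  assumes "pair_wf_digraph G"
    and "\<And>x y. (x, y) \<in> parcs G \<Longrightarrow> m dvd p y - p x - 1 \<or> m dvd p y - p x + 1"
    and "pre_digraph.awalk (with_proj G) u es v"
  obtains w where "m dvd p v - p u - w" "\<bar>w\<bar> \<le> int (length es)"
proof -
  interpret pair_wf_digraph G by fact
  have "\<exists>w. m dvd p v - p u - w \<and> \<bar>w\<bar> \<le> int (length es)"
    using assms(3)
  proof (induction es arbitrary: u)
    case Nil
    then show ?case by (auto simp: awalk_Nil_iff)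
  next
    case (Cons e es)
    then have e: "e \<in> parcs G" "fst e = u" and "awalk (snd e) es v"
      by (auto simp: awalk_Cons_iff)
    then obtain w where w: "m dvd p v - p (snd e) - w" "\<bar>w\<bar> \<le> int (length es)"
      using Cons.IH by blast
    from e assms(2)[of u "snd e"] consider "m dvd p (snd e) - p u - 1" | "m dvd p (snd e) - p u + 1"
      by (cases e) auto
    then show ?case
    proof cases
      case 1
      from dvd_add[OF w(1) 1] have "m dvd p v - p u - (w + 1)" by (simp add: algebra_simps)
      then show ?thesis using w(2) by (intro exI[of _ "w + 1"]) auto
    next
      case 2
      from dvd_add[OF w(1) 2] have "m dvd p v - p u - (w - 1)" by (simp add: algebra_simps)
      then show ?thesis using w(2) by (intro exI[of _ "w - 1"]) auto
    qed
  qed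
  then show ?thesis using that by blast
qed

lemma (in wf_digraph) awalk_cost_one: "awalk_cost (\<lambda>_. 1) es = real (length es)"
  by (induction es) simp_all

text \<open>
  The potential \<open>p\<close> places the vertices on a line (\<open>m = 0\<close>) or on a circle of length \<open>m\<close>, so that
  a walk of length \<open>l\<close> moves by some \<open>w\<close> with \<open>\<bar>w\<bar> \<le> l\<close>.
\<close>

lemma packing_coloringI:
  fixes p :: "'a \<Rightarrow> int"
  assumes G: "pair_wf_digraph G"
    and arcs: "\<And>x y. (x, y) \<in> parcs G \<Longrightarrow> m dvd p y - p x - 1 \<or> m dvd p y - p x + 1"
    and image: "\<phi> ` pverts G \<subseteq> {1..k}"
    and far: "\<And>u v w. \<lbrakk>u \<in> pverts G; v \<in> pverts G; u \<noteq> v; \<phi> u = \<phi> v; m dvd p v - p u - w\<rbrakk>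
      \<Longrightarrow> int (s (\<phi> u)) < \<bar>w\<bar>"
  shows "packing_coloring s G k \<phi>"
  unfolding packing_coloring_def
proof (intro conjI ballI impI image)
  fix u v assume uv: "u \<in> pverts G" "v \<in> pverts G" "u \<noteq> v" "\<phi> u = \<phi> v"
  interpret pair_wf_digraph G by fact
  have "ereal (real (s (\<phi> u) + 1)) \<le> gdist G u v"
    unfolding gdist_def \<mu>_def
  proof (rule INF_greatest)
    fix es assume "es \<in> {es. awalk u es v}"
    then obtain w where "m dvd p v - p u - w" "\<bar>w\<bar> \<le> int (length es)"
      using awalk_winding[of G m p u es v] G arcs by blast
    then have "s (\<phi> u) + 1 \<le> length es"
      using far[OF uv] by fastforce
    then show "ereal (real (s (\<phi> u) + 1)) \<le> ereal (awalk_cost (\<lambda>_. 1) es)"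
      by (simp add: awalk_cost_one)
  qed
  then show "ereal (real (s (\<phi> u))) < gdist G u v"
    by (rule less_le_trans[rotated]) simp
qed

text \<open>Distance is an infimum over all walks, so \<open>f\<close> may repeat vertices; this
  allows positions on an unrolled cycle.\<close>

lemma gdist_le_of_walk:
  assumes "pair_wf_digraph G"
    and "f i \<in> pverts G"
    and "\<And>k. i \<le> k \<Longrightarrow> k < i + d \<Longrightarrow> (f k, f (Suc k)) \<in> parcs G"
  shows "gdist G (f i) (f (i + d)) \<le> ereal (real d)"
proof -
  interpret pair_wf_digraph G by fact
  have "\<exists>es. awalk (f i) es (f (i + d)) \<and> length es = d"
    using assms(3)
  proof (induction d)
    case 0
    then show ?case using assms(2) by (auto simp: awalk_Nil_iff)
  next
    case (Suc d)
    then obtain es where es: "awalk (f i) es (f (i + d))" "length es = d" by force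
    have "(f (i + d), f (Suc (i + d))) \<in> parcs G" using Suc.prems by simp
    then have "awalk (f (i + d)) [(f (i + d), f (Suc (i + d)))] (f (i + Suc d))"
      by (auto simp: awalk_Cons_iff awalk_Nil_iff intro: wellformed')
    then show ?case using es by (intro exI[of _ "es @ [(f (i + d), f (Suc (i + d)))]"]) auto
  qed
  then show ?thesis
    using min_cost_le_walk_cost[of "f i" _ "f (i + d)" "\<lambda>_. 1"]
    unfolding gdist_def by (auto simp: awalk_cost_one)
qed

section \<open>Bounding the packing chromatic number\<close>

lemma packing_coloring_range:
  "packing_coloring s G k \<phi> \<Longrightarrow> v \<in> pverts G \<Longrightarrow> \<phi> v \<in> {1..k}"
  unfolding packing_coloring_def by blast

lemma packing_coloring_mono:
  "packing_coloring s G k \<phi> \<Longrightarrow> k \<le> l \<Longrightarrow> packing_coloring s G l \<phi>"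
  by (fastforce simp: packing_coloring_def)

lemma packing_chromatic_number_le:
  "packing_coloring s G k \<phi> \<Longrightarrow> packing_chromatic_number s G \<le> k"
  unfolding packing_chromatic_number_def by (auto intro: Least_le)

text \<open>A colouring stays valid with a larger palette, so excluding exactly \<open>k\<close>
  colours excludes all smaller numbers too.\<close>

lemma less_packing_chromatic_number:
  assumes "finite (pverts G)" and "\<And>\<phi>. \<not> packing_coloring s G k \<phi>"
  shows "k < packing_chromatic_number s G"
proof (rule ccontr)
  assume "\<not> ?thesis"
  moreover obtain \<phi> where "packing_coloring s G (packing_chromatic_number s G) \<phi>"
    unfolding packing_chromatic_number_def
    using LeastI_ex[OF packing_coloring_exists[OF assms(1), of s]] by blast
  ultimately show False using assms(2) packing_coloring_mono[of s G _ _ k] by (metis linorder_not_less)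
qed

section \<open>Colour sequences along consecutive positions\<close>

text \<open>
  The cutoff 8 allows \<open>I\<close> to be all of \<open>nat\<close> for the periodic unrolling of a coloured cycle of
  length at least 9: positions at distance at most 8 are then distinct vertices.
\<close>

definition locally_packing :: "(nat \<Rightarrow> nat) \<Rightarrow> (nat \<Rightarrow> nat) \<Rightarrow> nat set \<Rightarrow> bool" where
  "locally_packing s f I \<longleftrightarrow>
     (\<forall>i d. i \<in> I \<longrightarrow> i + d \<in> I \<longrightarrow> 0 < d \<longrightarrow> d \<le> 8 \<longrightarrow> f i = f (i + d) \<longrightarrow> s (f i) < d)"

lemma locally_packingD:
  "locally_packing s f I \<Longrightarrow> i \<in> I \<Longrightarrow> i + d \<in> I \<Longrightarrow> 0 < d \<Longrightarrow> d \<le> 8 \<Longrightarrow> f i = f (i + d) \<Longrightarrow>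
    s (f i) < d"
  unfolding locally_packing_def by blast

lemma locally_packing_subset: "locally_packing s f I \<Longrightarrow> J \<subseteq> I \<Longrightarrow> locally_packing s f J"
  unfolding locally_packing_def by blast

text \<open>\<open>g\<close> traces a walk, so two positions are at graph distance at most their
  index difference. Distinctness of vertices is asked only within the cutoff 8, so \<open>g\<close>
  may wind around a cycle.\<close>

lemma locally_packing_of_coloring:
  assumes "packing_coloring s G k \<phi>" and "pair_wf_digraph G"
    and "\<And>i. i \<in> I \<Longrightarrow> g i \<in> pverts G"
    and "\<And>i j. i \<in> I \<Longrightarrow> j \<in> I \<Longrightarrow> i < j \<Longrightarrow> j \<le> i + 8 \<Longrightarrow> g i \<noteq> g j"
    and "\<And>i k j. i \<in> I \<Longrightarrow> j \<in> I \<Longrightarrow> i \<le> k \<Longrightarrow> k < j \<Longrightarrow> (g k, g (Suc k)) \<in> parcs G"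
  shows "locally_packing s (\<lambda>i. \<phi> (g i)) I"
  unfolding locally_packing_def
proof (intro allI impI)
  fix i d assume *: "i \<in> I" "i + d \<in> I" "0 < d" "d \<le> 8" "\<phi> (g i) = \<phi> (g (i + d))"
  have "ereal (real (s (\<phi> (g i)))) < gdist G (g i) (g (i + d))"
    using assms(1) assms(3)[OF *(1)] assms(3)[OF *(2)] assms(4)[OF *(1,2)] *
    unfolding packing_coloring_def by auto
  also have "\<dots> \<le> ereal (real d)"
    using * assms(3,5) by (intro gdist_le_of_walk assms(2)) blast+
  finally show "s (\<phi> (g i)) < d" by simp
qed

text \<open>With colours 1 and 2 only, neither can repeat on neighbours, so they alternate; then two
  2s occur two steps apart, against \<open>2 \<le> s 2\<close>.\<close>

lemma window4:
  assumes "locally_packing s f {a..<a + 4}" "1 \<le> s 1" "2 \<le> s 2"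
  shows "\<exists>i\<in>{a..<a + 4}. f i \<noteq> 1 \<and> f i \<noteq> 2"
proof (rule ccontr)
  assume "\<not> ?thesis"
  then have v: "f (a + k) = 1 \<or> f (a + k) = 2" if "k < 4" for k
    using that by auto
  have d: "s (f (a + k)) < l - k" if "f (a + k) = f (a + l)" "k < l" "l < 4" for k l
    using locally_packingD[OF assms(1), of "a + k" "l - k"] that by auto
  have n1: "\<not> (f (a + k) = 1 \<and> f (a + Suc k) = 1)" if "k < 3" for k
    using d[of k "Suc k"] that assms(2) by auto
  have n2: "\<not> (f (a + k) = 2 \<and> f (a + l) = 2)" if "k < l" "l \<le> k + 2" "l < 4" for k l
    using d[of k l] that assms(3) by auto
  have alt: "f (a + k) = 1 \<longleftrightarrow> f (a + Suc k) = 2" if "k < 3" for k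
    using v[of k] v[of "Suc k"] n1[of k] n2[of k "Suc k"] that by auto
  show False
    using v[of 0] v[of 1] v[of 2] alt[of 0] alt[of 1] alt[of 2] n2[of 0 2] n2[of 1 3]
    by (auto simp: numeral_2_eq_2 numeral_3_eq_3)
qed

text \<open>Otherwise a 3 appears among the first four positions and another among the four
  positions right after it, at distance at most 4, against \<open>4 \<le> s 3\<close>.\<close>

lemma window8:
  assumes "locally_packing s f {a..<a + 8}" "1 \<le> s 1" "2 \<le> s 2" "4 \<le> s 3"
  shows "\<exists>i\<in>{a..<a + 8}. f i \<noteq> 1 \<and> f i \<noteq> 2 \<and> f i \<noteq> 3"
proof (rule ccontr)
  assume "\<not> ?thesis"
  then have 3: "f i = 3" if "i \<in> {a..<a + 8}" "f i \<noteq> 1" "f i \<noteq> 2" for i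
    using that by blast
  obtain i where i: "i \<in> {a..<a + 4}" "f i \<noteq> 1" "f i \<noteq> 2"
    using window4[of s f a] locally_packing_subset[OF assms(1)] assms(2,3) by auto
  obtain j where j: "j \<in> {i + 1..<i + 1 + 4}" "f j \<noteq> 1" "f j \<noteq> 2"
    using window4[of s f "i + 1"] locally_packing_subset[OF assms(1), of "{i + 1..<i + 1 + 4}"]
      i(1) assms(2,3) by auto
  have "f i = 3" "f j = 3" using 3 i j by auto
  moreover have "j - i \<le> 8" using j(1) by auto
  ultimately show False
    using locally_packingD[OF assms(1), of i "j - i"] i j assms(4) by auto
qed

text \<open>A single condition covering all three families. The upper bounds make the ruler pattern
  below a valid colouring; the lower bounds drive the counting arguments. The extra demands when
  \<open>s 4 = 6\<close> serve the separation of 4s.\<close>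

definition admissible :: "(nat \<Rightarrow> nat) \<Rightarrow> bool" where
  "admissible s \<longleftrightarrow> s 1 = 1 \<and> 2 \<le> s 2 \<and> s 2 \<le> 3 \<and> 4 \<le> s 3 \<and> s 3 \<le> 7 \<and>
     (s 4 = 7 \<or> s 4 = 6 \<and> s 2 = 3 \<and> 5 \<le> s 3)"

text \<open>The window is sized for the worst case \<open>r = 7\<close>: the 4s then sit at offsets
  2 and 9, with two further positions on either side.\<close>

lemma four_separated:
  assumes "locally_packing s f {a..<a + 12}" "admissible s"
    and "\<And>i. i \<in> {a..<a + 12} \<Longrightarrow> f i \<in> {1..4}"
    and "f (a + 2) = 4" "f (a + 2 + r) = 4" "0 < r" "r < 8"
  shows False
proof -
  have d: "k + s (f (a + k)) < l" if "f (a + k) = f (a + l)" "k < l" "l \<le> k + 8" "l < 12" for k l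
    using locally_packingD[OF assms(1), of "a + k" "l - k"] that
    by (auto simp: less_diff_conv le_diff_conv add.commute)
  \<comment> \<open>Only \<open>s 4 = 6\<close> and \<open>r = 7\<close> remain. The six positions in between must then read 1 2 1 3 1 2 or its
    mirror image, and the colouring cannot be continued by two positions to the right or left, respectively.\<close>
  have "s 4 < r" using d[of 2 "2 + r"] assms by (auto simp: ac_simps)
  then have "s 4 = 6" "s 2 = 3" "5 \<le> s 3" and r: "r = 7" and s1: "s 1 = 1"
    using assms(2,7) by (auto simp: admissible_def)
  define x where "x k = f (a + k)" for k
  have v: "x k = 1 \<or> x k = 2 \<or> x k = 3 \<or> x k = 4" if "k < 12" for k
    using assms(3)[of "a + k"] that by (force simp: x_def)
  have x4: "x 2 = 4" "x 9 = 4" using assms r by (auto simp: x_def ac_simps)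
  have n1: "\<not> (x k = 1 \<and> x l = 1)" if "k < l" "l \<le> k + 1" "l < 12" for k l
    using d[of k l] that s1 by (auto simp: x_def)
  have n2: "\<not> (x k = 2 \<and> x l = 2)" if "k < l" "l \<le> k + 3" "l < 12" for k l
    using d[of k l] that \<open>s 2 = 3\<close> by (auto simp: x_def)
  have n3: "\<not> (x k = 3 \<and> x l = 3)" if "k < l" "l \<le> k + 5" "l < 12" for k l
    using d[of k l] that \<open>5 \<le> s 3\<close> by (auto simp: x_def)
  have n4: "\<not> (x k = 4 \<and> x l = 4)" if "k < l" "l \<le> k + 6" "l < 12" for k l
    using d[of k l] that \<open>s 4 = 6\<close> by (auto simp: x_def)
  \<comment> \<open>Each of these positions is within distance 6 of offset 2 or offset 9.\<close>
  have w: "x k \<noteq> 4" if "k \<in> {0,1,3,4,5,6,7,8,10,11}" for k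
    using that n4[of 2 k] n4[of k 2] n4[of k 9] n4[of 9 k] x4 by auto
  have a: "x k = 1 \<or> x k = 2 \<or> x k = 3" if "k \<in> {0,1,3,4,5,6,7,8,10,11}" for k
    using w[OF that] v[of k] that by auto
  \<comment> \<open>With offsets 2 and 9 settled, what is left is propositional in the colours of
    the other ten; all conflicting pairs among them are listed.\<close>
  note inst = a[of 0] a[of 1] a[of 3] a[of 4] a[of 5] a[of 6] a[of 7] a[of 8] a[of 10] a[of 11]
    n1[of 0 1] n1[of 3 4] n1[of 4 5] n1[of 5 6] n1[of 6 7] n1[of 7 8] n1[of 10 11]
    n2[of 0 1] n2[of 0 3] n2[of 1 3] n2[of 1 4] n2[of 3 4] n2[of 3 5] n2[of 3 6] n2[of 4 5] n2[of 4 6] n2[of 4 7]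
    n2[of 5 6] n2[of 5 7] n2[of 5 8] n2[of 6 7] n2[of 6 8] n2[of 7 8] n2[of 7 10] n2[of 8 10] n2[of 8 11] n2[of 10 11]
    n3[of 0 1] n3[of 0 3] n3[of 0 4] n3[of 0 5] n3[of 1 3] n3[of 1 4] n3[of 1 5] n3[of 1 6]
    n3[of 3 4] n3[of 3 5] n3[of 3 6] n3[of 3 7] n3[of 3 8] n3[of 4 5] n3[of 4 6] n3[of 4 7] n3[of 4 8] n3[of 5 6]
    n3[of 5 7] n3[of 5 8] n3[of 5 10] n3[of 6 7] n3[of 6 8] n3[of 6 10] n3[of 6 11] n3[of 7 8] n3[of 7 10] n3[of 7 11]
    n3[of 8 10] n3[of 8 11] n3[of 10 11]
  show False using inst[simplified] by argo
qed

section \<open>The periodic ruler colouring\<close>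

text \<open>The ruler sequence capped at 4: one plus the exponent of 2 in \<open>i + 1\<close>, but
  at most 4. It lives on the integers because displacements along a cycle may be negative.\<close>

definition ruler :: "int \<Rightarrow> nat" where
  "ruler i = [1, 2, 1, 3, 1, 2, 1, 4] ! nat (i mod 8)"

lemma ruler_cases:
  obtains "ruler i = 1" "i mod 2 = 0" | "ruler i = 2" "i mod 4 = 1"
    | "ruler i = 3" "i mod 8 = 3" | "ruler i = 4" "i mod 8 = 7"
proof -
  have m: "i mod 2 = i mod 8 mod 2" "i mod 4 = i mod 8 mod 4" by (simp_all add: mod_mod_cancel)
  have "0 \<le> i mod 8" "i mod 8 < 8" by simp_all
  then have "i mod 8 \<in> {0, 1, 2, 3, 4, 5, 6, 7}" by force
  then show ?thesis
    using that unfolding m ruler_def by (auto simp: eval_nat_numeral)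
qed

lemma ruler_range: "1 \<le> ruler i" "ruler i \<le> 4"
  by (cases i rule: ruler_cases; simp)+

lemma ruler_cong: "8 dvd i - j \<Longrightarrow> ruler i = ruler j"
  by (simp only: ruler_def flip: mod_eq_dvd_iff)

text \<open>Colours 1, 2, 3, 4 occupy single residue classes modulo 2, 4, 8, 8, so equal colours are
  at least that modulus apart, which exceeds the matching entry of \<open>s\<close>.\<close>

lemma ruler_spacing:
  assumes "admissible s" "ruler i = ruler j" "i \<noteq> j"
  shows "int (s (ruler i)) < \<bar>i - j\<bar>"
proof -
  have s: "s 1 = 1" "s 2 \<le> 3" "s 3 \<le> 7" "s 4 \<le> 7"
    using assms(1) by (auto simp: admissible_def)
  have far: "m \<le> \<bar>i - j\<bar>" if "i mod m = j mod m" for m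
    using that assms(3) dvd_imp_le_int[of "i - j" m] by (auto simp: mod_eq_dvd_iff)
  show ?thesis
  proof (cases i rule: ruler_cases)
    case 1
    then have "j mod 2 = 0" using assms(2) by (cases j rule: ruler_cases) auto
    then show ?thesis using 1 s far[of 2] by simp
  next
    case 2
    then have "j mod 4 = 1" using assms(2) by (cases j rule: ruler_cases) auto
    then show ?thesis using 2 s far[of 4] by simp
  next
    case 3
    then have "j mod 8 = 3" using assms(2) by (cases j rule: ruler_cases) auto
    then show ?thesis using 3 s far[of 8] by simp
  next
    case 4
    then have "j mod 8 = 7" using assms(2) by (cases j rule: ruler_cases) auto
    then show ?thesis using 4 s far[of 8] by simp
  qed
qed

section \<open>Colourings of proper subgraphs and of cycles\<close>

lemma pair_wf_cycle_graph: "3 \<le> n \<Longrightarrow> pair_wf_digraph (cycle_graph n)"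
  by (meson pair_graph_cycle_graph pair_graph.axioms pair_digraph_def pair_fin_digraph_def)

lemma cycle_arc_iff:
  "(x, y) \<in> parcs (cycle_graph n) \<longleftrightarrow> x < n \<and> y < n \<and> (y = Suc x mod n \<or> x = Suc y mod n)"
  by (simp add: cycle_graph_def)

text \<open>A subgraph with every edge of the cycle also has every vertex, as an endpoint, and so is
  the whole cycle.\<close>

lemma proper_subgraph_missing_edge:
  assumes "pair_graph H" "subgraph (with_proj H) (with_proj (cycle_graph n))" "H \<noteq> cycle_graph n"
  obtains m where "m < n" "(m, Suc m mod n) \<notin> parcs H" "(Suc m mod n, m) \<notin> parcs H"
proof -
  interpret pair_graph H by fact
  have sub: "pverts H \<subseteq> {..<n}" "parcs H \<subseteq> parcs (cycle_graph n)"
    using assms(2) by (auto simp: subgraph_def cycle_graph_def)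
  have sym: "(y, x) \<in> parcs H" if "(x, y) \<in> parcs H" for x y
    using pair_sym_arcs that by (auto simp: symmetric_def sym_def)
  have "\<exists>m<n. (m, Suc m mod n) \<notin> parcs H"
  proof (rule ccontr)
    assume "\<not> ?thesis"
    then have all: "(m, Suc m mod n) \<in> parcs H" if "m < n" for m using that by blast
    have "parcs H = parcs (cycle_graph n)"
      using sub(2) all sym by (auto simp: cycle_arc_iff)
    moreover have "pverts H = pverts (cycle_graph n)"
      using sub(1) all by (auto simp: cycle_graph_def dest: in_arcsD1)
    ultimately show False using assms(3) by simp
  qed
  then show ?thesis using that sym by blast
qed

text \<open>Cutting the cycle at a missing edge lays the vertices out on a line, where the ruler
  pattern applies.\<close>

lemma proper_subgraph_coloring:
  assumes "pair_graph H" "subgraph (with_proj H) (with_proj (cycle_graph n))" "H \<noteq> cycle_graph n"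
    and s: "admissible s"
    and k: "\<And>i. 0 \<le> i \<Longrightarrow> i < int n \<Longrightarrow> ruler i \<le> k"
  shows "packing_chromatic_number s H \<le> k"
proof -
  interpret H: pair_graph H by fact
  have sub: "pverts H \<subseteq> {..<n}" "parcs H \<subseteq> parcs (cycle_graph n)"
    using assms(2) by (auto simp: subgraph_def cycle_graph_def)
  obtain m where m: "m < n" "(m, Suc m mod n) \<notin> parcs H" "(Suc m mod n, m) \<notin> parcs H"
    using proper_subgraph_missing_edge[OF assms(1-3)] .
  \<comment> \<open>Numbers the vertices from 0 at the one after \<open>m\<close>, around the cycle,
    to \<open>n - 1\<close> at \<open>m\<close>; only the missing edge fails to join consecutive
    numbers.\<close>
  define p :: "nat \<Rightarrow> int" where "p x = (if x \<le> m then int (x + n) else int x) - int m - 1" for x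
  have inj: "p u \<noteq> p v" if "u < n" "v < n" "u \<noteq> v" for u v
    using that by (auto simp: p_def)
  have range: "0 \<le> p u" "p u < int n" if "u < n" for u
    using that m(1) by (auto simp: p_def)
  have step: "p (Suc x mod n) = p x + 1" if "x < n" "x \<noteq> m" for x
    using that m(1) by (auto simp: p_def mod_Suc)
  have "packing_coloring s H k (\<lambda>x. ruler (p x))"
  \<comment> \<open>\<open>0 dvd x\<close> means \<open>x = 0\<close>, so displacements are exact
    differences of \<open>p\<close>. This modulus is unrelated to the vertex
    \<open>m\<close>.\<close>
  proof (rule packing_coloringI[where m = 0 and p = p])
    show "pair_wf_digraph H" by unfold_locales
    show "0 dvd p y - p x - 1 \<or> 0 dvd p y - p x + 1" if xy: "(x, y) \<in> parcs H" for x y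
    proof -
      have "x < n" "y < n" "y = Suc x mod n \<and> x \<noteq> m \<or> x = Suc y mod n \<and> y \<noteq> m"
        using xy sub(2) m by (auto simp: cycle_arc_iff)
      then show ?thesis using step[of x] step[of y] by auto
    qed
    show "(\<lambda>x. ruler (p x)) ` pverts H \<subseteq> {1..k}"
      using sub(1) range k ruler_range(1) by force
    show "int (s (ruler (p u))) < \<bar>w\<bar>"
      if "u \<in> pverts H" "v \<in> pverts H" "u \<noteq> v" "ruler (p u) = ruler (p v)" "0 dvd p v - p u - w"
      for u v w
      using ruler_spacing[OF s that(4)[symmetric]] inj[of v u] subsetD[OF sub(1)] that by auto
  qed
  then show ?thesis by (rule packing_chromatic_number_le)
qed

lemma cycle_step_dvd:
  assumes "(x, y) \<in> parcs (cycle_graph n)"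
  shows "int n dvd int y - int x - 1 \<or> int n dvd int y - int x + 1"
proof -
  have *: "int n dvd int (Suc z mod n) - int z - 1" for z
  proof -
    have "int (Suc z mod n) mod int n = (int z + 1) mod int n"
      by (simp add: zmod_int algebra_simps)
    then show ?thesis by (simp add: mod_eq_dvd_iff algebra_simps)
  qed
  have "int x - int y - 1 = - (int y - int x + 1)" by simp
  then show ?thesis using assms *[of x] *[of y]
    by (metis cycle_arc_iff dvd_minus_iff)
qed

text \<open>As 8 divides \<open>n\<close>, the ruler colour depends only on the position modulo
  \<open>n\<close>; a displacement \<open>w\<close> thus leads from \<open>u\<close> to an integer
  of the same colour, and the spacing on the line applies.\<close>

lemma cycle_coloring_mult8:
  assumes "admissible s" "3 \<le> n" "8 dvd n"
  shows "packing_chromatic_number s (cycle_graph n) \<le> 4"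
proof -
  have "packing_coloring s (cycle_graph n) 4 (\<lambda>x. ruler (int x))"
  proof (rule packing_coloringI[where m = "int n" and p = int])
    show "(\<lambda>x. ruler (int x)) ` pverts (cycle_graph n) \<subseteq> {1..4}"
      using ruler_range by auto
    fix u v w assume *: "u \<in> pverts (cycle_graph n)" "v \<in> pverts (cycle_graph n)" "u \<noteq> v"
      "ruler (int u) = ruler (int v)" "int n dvd int v - int u - w"
    have "8 dvd int v - (int u + w)"
      using *(5) assms(3) by (metis diff_diff_eq dvd_trans int_dvd_int_iff of_nat_numeral)
    then have r: "ruler (int u + w) = ruler (int u)"
      using ruler_cong *(4) by metis
    have "w \<noteq> 0"
      using * zdvd_imp_le[of "int n" "\<bar>int v - int u\<bar>"] by (auto simp: cycle_graph_def)
    then show "int (s (ruler (int u))) < \<bar>w\<bar>"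
      using ruler_spacing[OF assms(1) r] r by simp
  qed (use assms cycle_step_dvd pair_wf_cycle_graph in auto)
  then show ?thesis by (rule packing_chromatic_number_le)
qed

text \<open>The colours are 1, 2, 1, 3; only colour 1 repeats, on two opposite vertices at distance
  2.\<close>

lemma cycle_coloring_4:
  assumes "admissible s"
  shows "packing_chromatic_number s (cycle_graph 4) \<le> 3"
proof -
  have "packing_coloring s (cycle_graph 4) 3 (\<lambda>x. ruler (int x))"
  proof (rule packing_coloringI[where m = "int 4" and p = int])
    have four: "x = 0 \<or> x = 1 \<or> x = 2 \<or> x = 3" if "x < 4" for x :: nat using that by auto
    then show "(\<lambda>x. ruler (int x)) ` pverts (cycle_graph 4) \<subseteq> {1..3}"
      by (auto simp: ruler_def cycle_graph_def dest!: four)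
    fix u v w assume *: "u \<in> pverts (cycle_graph 4)" "v \<in> pverts (cycle_graph 4)" "u \<noteq> v"
      "ruler (int u) = ruler (int v)" "int 4 dvd int v - int u - w"
    have "u < 4" "v < 4" using * by (auto simp: cycle_graph_def)
    then have uv: "u = 0 \<and> v = 2 \<or> u = 2 \<and> v = 0"
      using *(3,4) by (auto simp: ruler_def dest!: four)
    have "2 \<le> \<bar>w\<bar>"
    proof -
      have "w \<noteq> 0 \<and> w \<noteq> 1 \<and> w \<noteq> - 1" using uv *(5) by auto
      then show ?thesis by arith
    qed
    then show "int (s (ruler (int u))) < \<bar>w\<bar>"
      using uv assms by (auto simp: ruler_def admissible_def)
  qed (use cycle_step_dvd[of _ _ 4] pair_wf_cycle_graph in auto)
  then show ?thesis by (rule packing_chromatic_number_le)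
qed

section \<open>Lower bounds for cycles\<close>

text \<open>For \<open>n \<le> 8\<close> two positions within the cutoff may be the same vertex,
  hence the restriction of \<open>I\<close> to one period.\<close>

lemma cycle_locally_packing:
  assumes "packing_coloring s (cycle_graph n) k \<phi>" "3 \<le> n" "n \<le> 8 \<Longrightarrow> I \<subseteq> {a..<a + n}"
  shows "locally_packing s (\<lambda>i. \<phi> (i mod n)) I"
proof (rule locally_packing_of_coloring[OF assms(1) pair_wf_cycle_graph[OF assms(2)]])
  show "i mod n \<in> pverts (cycle_graph n)" for i
    using assms(2) by (simp add: cycle_graph_def)
  show "i mod n \<noteq> j mod n" if "i \<in> I" "j \<in> I" "i < j" "j \<le> i + 8" for i j
  proof
    assume "i mod n = j mod n"
    then have "n dvd j - i" using that(3) by (metis mod_eq_dvd_iff_nat nat_less_le)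
    then have "n \<le> j - i" using that(3) by (simp add: dvd_imp_le)
    then have "I \<subseteq> {a..<a + n}" using that assms(3) by simp
    then have "a \<le> i" "j < a + n" using that by auto
    then show False using \<open>n \<le> j - i\<close> that by auto
  qed
  show "(k mod n, Suc k mod n) \<in> parcs (cycle_graph n)" for k
    using assms(2) by (simp add: cycle_arc_iff mod_Suc_eq)
qed

lemma cycle3_lower:
  assumes "admissible s"
  shows "2 < packing_chromatic_number s (cycle_graph 3)"
proof (rule less_packing_chromatic_number)
  show "finite (pverts (cycle_graph 3))" by (simp add: cycle_graph_def)
  fix \<phi> show "\<not> packing_coloring s (cycle_graph 3) 2 \<phi>"
  proof
    assume c: "packing_coloring s (cycle_graph 3) 2 \<phi>"
    have l: "locally_packing s (\<lambda>i. \<phi> (i mod 3)) {a..<a + 3}" for a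
      by (rule cycle_locally_packing[OF c, where a = a]) auto
    have "\<phi> i = 1 \<or> \<phi> i = 2" if "i < 3" for i
      using packing_coloring_range[OF c, of i] that by (force simp: cycle_graph_def)
    from this[of 0] this[of 1] this[of 2] show False
      \<comment> \<open>The window starting at 2 supplies the closing edge from vertex 2 to vertex
        0, seen as positions 2 and 3.\<close>
      using locally_packingD[OF l[of 0], of 0 1] locally_packingD[OF l[of 0], of 0 2]
        locally_packingD[OF l[of 0], of 1 1] locally_packingD[OF l[of 2], of 2 1] assms
      by (auto simp: admissible_def numeral_2_eq_2)
  qed
qed

text \<open>With three colours, a 3 at \<open>i\<close> is followed by another at most 4 steps
  later. As \<open>n \<ge> 5\<close>, this is a different vertex, against
  \<open>4 \<le> s 3\<close>.\<close>

lemma short_cycle_lower: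
  assumes "admissible s" "5 \<le> n" "n \<le> 8"
  shows "3 < packing_chromatic_number s (cycle_graph n)"
proof (rule less_packing_chromatic_number)
  show "finite (pverts (cycle_graph n))" by (simp add: cycle_graph_def)
  fix \<phi> show "\<not> packing_coloring s (cycle_graph n) 3 \<phi>"
  proof
    assume c: "packing_coloring s (cycle_graph n) 3 \<phi>"
    let ?f = "\<lambda>i. \<phi> (i mod n)"
    have l: "locally_packing s ?f {a..<a + n}" for a
      by (rule cycle_locally_packing[OF c, where a = a]) (use assms in auto)
    have f3: "?f i = 3" if "?f i \<noteq> 1" "?f i \<noteq> 2" for i
    proof -
      have "?f i \<in> {1..3}" using assms(2) by (intro packing_coloring_range[OF c]) (simp add: cycle_graph_def)
      then show ?thesis using that by auto
    qed
    have l4: "locally_packing s ?f {a..<a + 4}" for a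
      using l[of a] assms(2) by (auto intro: locally_packing_subset)
    have w: "\<exists>i\<in>{a..<a + 4}. ?f i = 3" for a
      using window4[OF l4] f3 assms(1) by (fastforce simp: admissible_def)
    obtain i where i: "?f i = 3" using w by blast
    obtain j where j: "j \<in> {i + 1..<i + 1 + 4}" "?f j = 3" using w by blast
    have "s (?f i) < j - i"
      using i j assms(2) by (intro locally_packingD[OF l[of i]]) auto
    then show False using i j assms(1) by (auto simp: admissible_def)
  qed
qed

lemma long_cycle_lower:
  assumes "admissible s" "9 \<le> n" "n mod 8 \<noteq> 0"
  shows "4 < packing_chromatic_number s (cycle_graph n)"
proof (rule less_packing_chromatic_number)
  show "finite (pverts (cycle_graph n))" by (simp add: cycle_graph_def)
  fix \<phi> show "\<not> packing_coloring s (cycle_graph n) 4 \<phi>"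
  proof
    assume c: "packing_coloring s (cycle_graph n) 4 \<phi>"
    define f where "f i = \<phi> (i mod n)" for i
    \<comment> \<open>Since \<open>n \<ge> 9\<close>, the restriction on \<open>I\<close> for short
      cycles is vacuous.\<close>
    have l: "locally_packing s f I" for I
      unfolding f_def by (rule cycle_locally_packing[OF c]) (use assms in auto)
    have v: "f i \<in> {1..4}" for i
      unfolding f_def using assms(2) by (intro packing_coloring_range[OF c]) (simp add: cycle_graph_def)
    have per: "f (i + n) = f i" for i by (simp add: f_def)
    have sep: "f (i + r) \<noteq> 4" if "f i = 4" "0 < r" "r < 8" for i r
    proof
      assume "f (i + r) = 4"
      \<comment> \<open>Shifting by one period makes room for the two positions to the left of the
        first 4.\<close>
      moreover have "i + n - 2 + 2 = i + n" using assms(2) by simp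
      ultimately show False
        using four_separated[OF l[of "{i + n - 2..<i + n - 2 + 12}"] assms(1), of r] that v
          per[of i] per[of "i + r"] by (metis add.assoc add.commute)
    qed
    have ex: "\<exists>i\<in>{a..<a + 8}. f i = 4" for a
    proof -
      obtain i where "i \<in> {a..<a + 8}" "f i \<noteq> 1" "f i \<noteq> 2" "f i \<noteq> 3"
        using window8[OF l] assms(1) by (fastforce simp: admissible_def)
      moreover from this have "f i = 4" using v[of i] by auto
      ultimately show ?thesis by blast
    qed
    obtain i where i: "f i = 4" using ex by blast
    have next4: "f (j + 8) = 4" if j: "f j = 4" for j
    proof -
      \<comment> \<open>The window covers distances 1 to 8 from \<open>j\<close>, and
        \<open>sep\<close> rules out all but the last.\<close>
      obtain r where r: "r \<in> {j + 1..<j + 1 + 8}" "f r = 4" using ex by blast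
      have "\<not> r - j < 8" using sep[OF j, of "r - j"] r by auto
      then have "r = j + 8" using r(1) by auto
      then show ?thesis using r by simp
    qed
    have "f (i + 8 * q) = 4" for q
    proof (induction q)
      case (Suc q)
      then show ?case using next4[of "i + 8 * q"] by (simp add: algebra_simps)
    qed (use i in simp)
    then have "f (i + 8 * (n div 8)) = 4" .
    \<comment> \<open>Position \<open>i + n\<close> lies between 1 and 7 steps after this 4, yet
      periodicity makes it a 4 as well.\<close>
    from sep[OF this, of "n mod 8"] have "f (i + n) \<noteq> 4"
      using assms(3) by (simp add: add.assoc)
    then show False using per i by simp
  qed
qed

section \<open>The spanning path as a witness against criticality\<close>

definition path_graph :: "nat \<Rightarrow> nat pair_pre_digraph" where
  "path_graph n = \<lparr> pverts = {..<n}, parcs = {(u, v). u < n \<and> v < n \<and> (v = Suc u \<or> u = Suc v)} \<rparr>"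

lemma pair_graph_path_graph: "pair_graph (path_graph n)"
proof -
  have "finite (parcs (path_graph n))"
    by (rule finite_subset[of _ "{..<n} \<times> {..<n}"]) (auto simp: path_graph_def)
  then show ?thesis
    by unfold_locales (auto simp: path_graph_def symmetric_def sym_def)
qed

lemma path_subgraph_cycle:
  assumes "3 \<le> n"
  shows "subgraph (with_proj (path_graph n)) (with_proj (cycle_graph n))" "path_graph n \<noteq> cycle_graph n"
proof -
  have "wf_digraph (with_proj (path_graph n))" "wf_digraph (with_proj (cycle_graph n))"
    using pair_graph_path_graph[of n] pair_wf_cycle_graph[OF assms]
    by (simp_all add: wf_digraph_wp_iff pair_graph_def pair_digraph_def pair_fin_digraph_def)
  then show "subgraph (with_proj (path_graph n)) (with_proj (cycle_graph n))"
    by (auto simp: subgraph_def compatible_def path_graph_def cycle_graph_def)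
  have "(n - 1, 0) \<in> parcs (cycle_graph n)" "(n - 1, 0) \<notin> parcs (path_graph n)"
    using assms by (auto simp: path_graph_def cycle_graph_def)
  then show "path_graph n \<noteq> cycle_graph n" by auto
qed

lemma path_locally_packing:
  assumes "packing_coloring s (path_graph n) k \<phi>" "I \<subseteq> {..<n}"
  shows "locally_packing s \<phi> I"
proof (rule locally_packing_of_coloring[OF assms(1)])
  show "pair_wf_digraph (path_graph n)"
    using pair_graph_path_graph[of n] by (simp add: pair_graph_def pair_digraph_def pair_fin_digraph_def)
qed (use assms(2) in \<open>auto simp: path_graph_def\<close>)

text \<open>The first 4 or 8 vertices already form a window that forces a colour above 2 or above
  3.\<close>

lemma path_lower:
  assumes "admissible s"
  shows "4 \<le> n \<Longrightarrow> 2 < packing_chromatic_number s (path_graph n)"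
    and "8 \<le> n \<Longrightarrow> 3 < packing_chromatic_number s (path_graph n)"
proof -
  have fin: "finite (pverts (path_graph n))" by (simp add: path_graph_def)
  have s: "1 \<le> s 1" "2 \<le> s 2" "4 \<le> s 3" using assms by (auto simp: admissible_def)
  have range: "\<phi> i \<in> {1..k}" if "packing_coloring s (path_graph n) k \<phi>" "i < n" for \<phi> k i
    using packing_coloring_range[OF that(1)] that(2) by (simp add: path_graph_def)
  show "2 < packing_chromatic_number s (path_graph n)" if "4 \<le> n"
  proof (rule less_packing_chromatic_number[OF fin], rule notI)
    fix \<phi> assume c: "packing_coloring s (path_graph n) 2 \<phi>"
    have l: "locally_packing s \<phi> {0..<0 + 4}"
      using that by (intro path_locally_packing[OF c]) auto
    from window4[OF l s(1,2)] obtain i where i: "i \<in> {0..<0 + 4}" "\<phi> i \<noteq> 1" "\<phi> i \<noteq> 2"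
      by blast
    then have "i < n" using that by simp
    then show False using range[OF c, of i] i by auto
  qed
  show "3 < packing_chromatic_number s (path_graph n)" if "8 \<le> n"
  proof (rule less_packing_chromatic_number[OF fin], rule notI)
    fix \<phi> assume c: "packing_coloring s (path_graph n) 3 \<phi>"
    have l: "locally_packing s \<phi> {0..<0 + 8}"
      using that by (intro path_locally_packing[OF c]) auto
    from window8[OF l s] obtain i where i: "i \<in> {0..<0 + 8}" "\<phi> i \<noteq> 1" "\<phi> i \<noteq> 2" "\<phi> i \<noteq> 3"
      by blast
    then have "i < n" using that by simp
    then show False using range[OF c, of i] i by auto
  qed
qed

section \<open>Criticality by comparing the cycle with its proper subgraphs\<close>

theorem theorem4p3:
  fixes n :: nat and s :: "nat \<Rightarrow> nat"
  assumes "n \<ge> 3"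
    and "s \<in> packing_seqs 1 2 4 7 \<union> packing_seqs 1 3 4 7 \<union> packing_seqs 1 3 5 6"
  shows "chi_critical s (cycle_graph n) \<longleftrightarrow> n mod 8 \<noteq> 0 \<and> n \<noteq> 4"
proof
  have s: "admissible s"
    using assms(2) by (auto simp: packing_seqs_def admissible_def)
  {
    assume "chi_critical s (cycle_graph n)"
    then have less: "packing_chromatic_number s (path_graph n) < packing_chromatic_number s (cycle_graph n)"
      using path_subgraph_cycle[OF assms(1)] pair_graph_path_graph unfolding chi_critical_def by blast
    show "n mod 8 \<noteq> 0 \<and> n \<noteq> 4"
    proof (intro conjI notI)
      assume "n mod 8 = 0"
      then have "8 dvd n" by auto
      then have "8 \<le> n" using assms(1) by (auto dest: dvd_imp_le)
      then show False
        using less path_lower(2)[OF s, of n] cycle_coloring_mult8[OF s assms(1) \<open>8 dvd n\<close>] by simp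
    next
      assume "n = 4"
      then show False using less path_lower(1)[OF s, of n] cycle_coloring_4[OF s] by simp
    qed
  }
  assume n: "n mod 8 \<noteq> 0 \<and> n \<noteq> 4"
  \<comment> \<open>The largest ruler colour on positions 0 to \<open>n - 1\<close>: enough for
    every proper subgraph, too few for the cycle.\<close>
  define k :: nat where "k = (if n = 3 then 2 else if n \<le> 7 then 3 else 4)"
  have "k < packing_chromatic_number s (cycle_graph n)"
  proof -
    consider "n = 3" | "5 \<le> n" "n \<le> 7" | "9 \<le> n"
      using n assms(1) by (cases "n = 8") force+
    then show ?thesis
      using cycle3_lower[OF s] short_cycle_lower[OF s, of n] long_cycle_lower[OF s, of n] n
      by cases (auto simp: k_def)
  qed
  moreover have "ruler i \<le> k" if "0 \<le> i" "i < int n" for i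
  proof -
    have "ruler i \<le> 2" if "i \<in> {0, 1, 2}"
      using that by (auto simp: ruler_def eval_nat_numeral)
    moreover have "ruler i \<le> 3" if "i \<in> {0, 1, 2, 3, 4, 5, 6}"
      using that by (auto simp: ruler_def eval_nat_numeral)
    moreover have "ruler i \<le> 4" by (rule ruler_range)
    moreover have "i \<in> {0, 1, 2}" if "i < 3" using that \<open>0 \<le> i\<close> by force
    moreover have "i \<in> {0, 1, 2, 3, 4, 5, 6}" if "i < 7" using that \<open>0 \<le> i\<close> by force
    moreover have "i < 3" if "n = 3" using that \<open>i < int n\<close> by simp
    moreover have "i < 7" if "n \<le> 7" using that \<open>i < int n\<close> by simp
    ultimately show ?thesis unfolding k_def by (cases "n = 3"; cases "n \<le> 7") simp_all
  qed
  ultimately show "chi_critical s (cycle_graph n)"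
    unfolding chi_critical_def using proper_subgraph_coloring[OF _ _ _ s] le_less_trans by blast
qed

end
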